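(* Let $p$ be a prime and let $a=(a(n))_{n\ge 0}\in\mathbb Z_p^{\mathbb N}$ be a sequence of $p$-adic integers such that $a \bmod p^\alpha=(a(n) \bmod p^\alpha)_{n\ge 0}$ is $p$-automatic for each $\alpha\ge 0$. Let $\mathcal M_\alpha$ be the minimal automaton generating $a\bmod p^\alpha$ in direct reading. Then $(\mathcal M_\alpha)_{\alpha\ge 0}$ is an inverse family of finite automata.
   Context: For $k\ge 2$ let $\Sigma_k=\{0,1,\dots,k-1\}$. A $k$-DAO (deterministic automaton with output) is a tuple $(\mathcal S,\Sigma_k,\delta,\overline s,\mathcal A,\tau)$ with $\mathcal S$ a set of states, $\overline s\in\mathcal S$ the initial state, $\delta:\mathcal S\times\Sigma_k\to\mathcal S$ the transition function, $\mathcal A$ an output alphabet and $\tau:\mathcal S\to\mathcal A$ the output function. It is a $k$-DFAO (finite) if $\mathcal S$ is finite. The function $\delta$ extends to $\mathcal S\times\Sigma_k^*$ by $\delta(s,\epsilon)=s$ for the empty word $\epsilon$ and $\delta(s,n_\ell n_{\ell-1}\cdots n_0)=\delta(\delta(s,n_\ell),n_{\ell-1}\cdots n_0)$. For $n\ge 0$, $\mathrm{rep}_k(n)=n_\ell\cdots n_1n_0$ is the standard base-$k$ representation of $n$, with $n=n_\ell k^\ell+\dots+n_1k+n_0$ and $n_\ell\ne0$ (and $\mathrm{rep}_k(0)=\epsilon$). A sequence $(b(n))_{n\ge0}$ is $k$-automatic if there is a $k$-DFAO with $b(n)=\tau(\delta(\overline s,\mathrm{rep}_k(n)))$ for each $n\ge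 0$; since the most significant digit is read first, the automaton is said to generate $(b(n))_{n\ge 0}$ in direct reading. Two $k$-DAO's are equivalent if they determine the same function $\Sigma_k^*\to\mathcal A$ given by $w\mapsto\tau(\delta(\overline s,w))$. A $k$-DFAO with the fewest states in its equivalence class is said to be minimal; given a $k$-DFAO, there is a unique minimal automaton equivalent to it, up to renaming states. A morphism from a $k$-DAO $(\mathcal S,\Sigma_k,\delta,\overline s,\mathcal A,\tau)$ to a $k$-DAO $(\mathcal S',\Sigma_k,\delta',\overline s',\mathcal A',\tau')$ consists of maps $\psi:\mathcal S\to\mathcal S'$ and $\pi:\mathcal A\to\mathcal A'$ such that $\psi(\overline s)=\overline s'$, $\psi(\delta(s,i))=\delta'(\psi(s),i)$ and $\pi(\tau(s))=\tau'(\psi(s))$ for all $s\in\mathcal S$ and $i\in\Sigma_k$. For $0\le\alpha\le\beta$ let $\pi_{\alpha,\beta}:\mathbb Z/(p^\beta\mathbb Z)\to\mathbb Z/(p^\alpha\mathbb Z)$ be the natural projection. A sequence of finite automata $(\mathcal M_\alpha)_{\alpha\ge 0}=(\mathcal S_\alpha,\Sigma_p,\delta_\alpha,\overline s_\alpha,\mathbb Z/(p^\alpha\mathbb Z),\tau_\alpha)_{\alpha\ge0}$ is an inverse family of finite automata if for each $0\le\alpha\le\beta$ there is a morphism from $\mathcal M_\beta$ to $\mathcal M_\alpha$, consisting of a map $\psi_{\alpha,\beta}:\mathcal S_\beta\to\mathcal S_\alpha$ and the projection map $\pi_{\alpha,\beta}$, such that $\psi_{\alpha,\gamma}=\psi_{\alpha,\beta}\circ\psi_{\beta,\gamma}$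 whenever $0\le\alpha\le\beta\le\gamma$.
   Formalization: "The minimal automaton generating a mod p^α in direct reading" is taken to be the minimal one whose output is unchanged by leading zeros; as stated, generation only fixes outputs on standard representations, so it is not unique and the claim can fail for mixed choices. *)

theory Defs
  imports "HOL-Number_Theory.Residues"
begin

section \<open>Deterministic automata with output\<close>

text \<open>The alphabet \<open>{0, ..., k - 1}\<close> is \<open>{..<k}\<close>. Maps on states are total HOL functions, of
  which only the values on the carrier sets matter.\<close>

record ('s, 'o) dao =
  states :: "'s set"
  init :: 's
  trans :: "'s \<Rightarrow> nat \<Rightarrow> 's"
  outputs :: "'o set"
  out :: "'s \<Rightarrow> 'o"

definition is_dao :: "nat \<Rightarrow> ('s, 'o) dao \<Rightarrow> bool" where
  "is_dao k M \<longleftrightarrow> 2 \<le> k \<and> init M \<in> states M \<and>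
     (\<forall>s\<in>states M. \<forall>i<k. trans M s i \<in> states M) \<and>
     (\<forall>s\<in>states M. out M s \<in> outputs M)"

definition is_dfao :: "nat \<Rightarrow> ('s, 'o) dao \<Rightarrow> bool" where
  "is_dfao k M \<longleftrightarrow> is_dao k M \<and> finite (states M)"

text \<open>A word is the list of its letters, the head being read first.\<close>

fun run :: "('s, 'o) dao \<Rightarrow> 's \<Rightarrow> nat list \<Rightarrow> 's" where
  "run M s [] = s"
| "run M s (i # w) = run M (trans M s i) w"

definition word_fun :: "('s, 'o) dao \<Rightarrow> nat list \<Rightarrow> 'o" where
  "word_fun M w = out M (run M (init M) w)"

section \<open>Base-\<open>k\<close> representations and automatic sequences\<close>

text \<open>Most significant digit first. The guard \<open>k < 2\<close> only ensures termination; the two lemmas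
  below say that, for \<open>k \<ge> 2\<close>, this is the standard representation.\<close>

function rep :: "nat \<Rightarrow> nat \<Rightarrow> nat list" where
  "rep k n = (if k < 2 \<or> n = 0 then [] else rep k (n div k) @ [n mod k])"
  by auto
termination by (relation "measure snd") auto

declare rep.simps [simp del]

lemma rep_value: "2 \<le> k \<Longrightarrow> horner_sum (\<lambda>d. d) k (rev (rep k n)) = n"
proof (induction k n rule: rep.induct)
  case (1 k n)
  then show ?case by (subst rep.simps) auto
qed

lemma rep_digits:
  "2 \<le> k \<Longrightarrow> set (rep k n) \<subseteq> {..<k} \<and> (rep k n = [] \<longleftrightarrow> n = 0) \<and> (n \<noteq> 0 \<longrightarrow> hd (rep k n) \<noteq> 0)"
proof (induction k n rule: rep.induct)
  case (1 k n)
  show ?case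
  proof (cases "n = 0")
    case True
    then show ?thesis by (simp add: rep.simps)
  next
    case False
    with 1 have IH: "set (rep k (n div k)) \<subseteq> {..<k}"
      "rep k (n div k) = [] \<longleftrightarrow> n div k = 0" "n div k \<noteq> 0 \<longrightarrow> hd (rep k (n div k)) \<noteq> 0"
      by auto
    have e: "rep k n = rep k (n div k) @ [n mod k]"
      using False 1 by (subst rep.simps) simp
    show ?thesis
    proof (cases "n div k = 0")
      case True
      then have "n < k" using 1 by (auto simp: div_eq_0_iff)
      with True IH False show ?thesis by (simp add: e)
    next
      case F: False
      with IH False 1 show ?thesis by (simp add: e)
    qed
  qed
qed

definition generates_direct :: "nat \<Rightarrow> ('s, 'o) dao \<Rightarrow> (nat \<Rightarrow> 'o) \<Rightarrow> bool" where
  "generates_direct k M b \<longleftrightarrow> (\<forall>n. b n = word_fun M (rep k n))"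

text \<open>Every finite state set is in bijection with a set of natural numbers, so restricting the
  existentially quantified automaton here, and the competing automata in \<open>minimal_dfao\<close> below, to
  states of type \<^typ>\<open>nat\<close> loses nothing.\<close>

definition automatic :: "nat \<Rightarrow> (nat \<Rightarrow> 'o) \<Rightarrow> bool" where
  "automatic k b \<longleftrightarrow> (\<exists>M :: (nat, 'o) dao. is_dfao k M \<and> generates_direct k M b)"

section \<open>Equivalence and minimality\<close>

definition equivalent :: "nat \<Rightarrow> ('s, 'o) dao \<Rightarrow> ('t, 'o) dao \<Rightarrow> bool" where
  "equivalent k M M' \<longleftrightarrow> outputs M = outputs M' \<and>
     (\<forall>w. set w \<subseteq> {..<k} \<longrightarrow> word_fun M w = word_fun M' w)"

definition minimal_dfao :: "nat \<Rightarrow> ('s, 'o) dao \<Rightarrow> bool" where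
  "minimal_dfao k M \<longleftrightarrow> is_dfao k M \<and>
     (\<forall>M' :: (nat, 'o) dao. is_dfao k M' \<and> equivalent k M M' \<longrightarrow> card (states M) \<le> card (states M'))"

definition ignores_leading_zeros :: "nat \<Rightarrow> ('s, 'o) dao \<Rightarrow> bool" where
  "ignores_leading_zeros k M \<longleftrightarrow>
     (\<forall>w. set w \<subseteq> {..<k} \<longrightarrow> word_fun M (0 # w) = word_fun M w)"

text \<open>``The minimal automaton generating \<open>b\<close> in direct reading'' (with output alphabet \<open>A\<close>).
  Generating \<open>b\<close> fixes the output only on words without leading zeros, and hence does not fix an
  equivalence class. Here the usual convention is followed that leading zeros do not affect
  the output. Then the output on every word is determined by \<open>b\<close>, and the minimal automaton is
  unique up to renaming of states.\<close>

definition minimal_generator :: "nat \<Rightarrow> 'o set \<Rightarrow> (nat \<Rightarrow> 'o) \<Rightarrow> ('s, 'o) dao \<Rightarrow> bool" where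
  "minimal_generator k A b M \<longleftrightarrow> outputs M = A \<and> generates_direct k M b \<and>
     ignores_leading_zeros k M \<and> minimal_dfao k M"

section \<open>Morphisms and inverse families\<close>

definition dao_morphism ::
    "nat \<Rightarrow> ('s, 'o) dao \<Rightarrow> ('t, 'q) dao \<Rightarrow> ('s \<Rightarrow> 't) \<Rightarrow> ('o \<Rightarrow> 'q) \<Rightarrow> bool" where
  "dao_morphism k M M' \<psi> \<pi> \<longleftrightarrow>
     \<psi> \<in> states M \<rightarrow> states M' \<and> \<pi> \<in> outputs M \<rightarrow> outputs M' \<and>
     \<psi> (init M) = init M' \<and>
     (\<forall>s\<in>states M. \<forall>i<k. \<psi> (trans M s i) = trans M' (\<psi> s) i) \<and>
     (\<forall>s\<in>states M. \<pi> (out M s) = out M' (\<psi> s))"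

text \<open>Elements of \<open>\<int>/(p^\<alpha> \<int>)\<close> are represented by the integers \<open>0, ..., p^\<alpha> - 1\<close>, so the
  projection from \<open>\<int>/(p^\<beta> \<int>)\<close> is reduction modulo \<open>p^\<alpha>\<close>, whatever \<open>\<beta> \<ge> \<alpha>\<close> is.\<close>

abbreviation Zmod :: "nat \<Rightarrow> nat \<Rightarrow> int set" where
  "Zmod p \<alpha> \<equiv> carrier (residue_ring (int p ^ \<alpha>))"

definition proj :: "nat \<Rightarrow> nat \<Rightarrow> int \<Rightarrow> int" where
  "proj p \<alpha> x = x mod (int p ^ \<alpha>)"

definition inverse_family :: "nat \<Rightarrow> (nat \<Rightarrow> ('s, int) dao) \<Rightarrow> bool" where
  "inverse_family p M \<longleftrightarrow>
     (\<forall>\<alpha>. is_dfao p (M \<alpha>) \<and> outputs (M \<alpha>) = Zmod p \<alpha>) \<and>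
     (\<exists>\<psi> :: nat \<Rightarrow> nat \<Rightarrow> 's \<Rightarrow> 's.
        (\<forall>\<alpha> \<beta>. \<alpha> \<le> \<beta> \<longrightarrow> dao_morphism p (M \<beta>) (M \<alpha>) (\<psi> \<alpha> \<beta>) (proj p \<alpha>)) \<and>
        (\<forall>\<alpha> \<beta> \<gamma>. \<alpha> \<le> \<beta> \<longrightarrow> \<beta> \<le> \<gamma> \<longrightarrow>
           (\<forall>s\<in>states (M \<gamma>). \<psi> \<alpha> \<gamma> s = \<psi> \<alpha> \<beta> (\<psi> \<beta> \<gamma> s))))"

section \<open>\<open>p\<close>-adic integers\<close>

text \<open>Inverse limit of the rings \<open>\<int>/(p^\<alpha> \<int>)\<close>: a \<open>p\<close>-adic integer is the compatible sequence
  of its residues. Only the underlying set and the reduction maps are needed.\<close>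

definition padic_ints :: "nat \<Rightarrow> (nat \<Rightarrow> int) set" where
  "padic_ints p = {x. (\<forall>\<alpha>. x \<alpha> \<in> Zmod p \<alpha>) \<and> (\<forall>\<alpha> \<beta>. \<alpha> \<le> \<beta> \<longrightarrow> proj p \<alpha> (x \<beta>) = x \<alpha>)}"

definition padic_mod :: "nat \<Rightarrow> (nat \<Rightarrow> int) \<Rightarrow> int" where
  "padic_mod \<alpha> x = x \<alpha>"

end

theory Submission
  imports Defs
begin

text \<open>In a minimal automaton every state is reached by some word, and distinct states are told
  apart by some word. The output of \<open>M \<alpha>\<close> on a word is the reduction modulo \<open>p^\<alpha>\<close> of the output
  of \<open>M \<beta>\<close>, so two words leading to the same state of \<open>M \<beta>\<close> lead to indistinguishable, hence
  equal, states of \<open>M \<alpha>\<close>. Sending the state reached by \<open>w\<close> in \<open>M \<beta>\<close> to the state reached by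
  \<open>w\<close> in \<open>M \<alpha>\<close> is therefore well defined, and it is visibly functorial.\<close>

lemma run_append: "run M s (v @ w) = run M (run M s v) w"
  by (induction v arbitrary: s) auto

lemma run_in_states:
  assumes "is_dao k M" "s \<in> states M" "w \<in> lists {..<k}"
  shows "run M s w \<in> states M"
  using assms(3,2) assms(1) by (induction w arbitrary: s) (auto simp: is_dao_def)

lemma rep_snoc:
  assumes "2 \<le> k" "i < k" "n \<noteq> 0 \<or> i \<noteq> 0"
  shows "rep k (n * k + i) = rep k n @ [i]"
  using assms by (subst rep.simps) auto

lemma word_eq_zeros_rep:
  assumes "2 \<le> k" "w \<in> lists {..<k}"
  shows "\<exists>j n. w = replicate j 0 @ rep k n"
  using assms(2)
proof (induction w rule: rev_induct)
  case Nil
  then show ?case by (auto simp: rep.simps intro: exI[of _ 0])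
next
  case (snoc i w)
  then obtain j n where w: "w = replicate j 0 @ rep k n" by auto
  show ?case
  proof (cases "n = 0 \<and> i = 0")
    case True
    then have "w @ [i] = replicate (Suc j) 0 @ rep k 0"
      using w by (simp add: rep.simps replicate_append_same)
    then show ?thesis by blast
  next
    case False
    then have "w @ [i] = replicate j 0 @ rep k (n * k + i)"
      using w snoc.prems assms(1) by (simp add: rep_snoc)
    then show ?thesis by blast
  qed
qed

lemma rep_in_lists: "2 \<le> k \<Longrightarrow> rep k n \<in> lists {..<k}"
  using rep_digits[of k n] by blast

lemma word_fun_leading_zeros:
  assumes "ignores_leading_zeros k M" "0 < k" "w \<in> lists {..<k}"
  shows "word_fun M (replicate j 0 @ w) = word_fun M w"
proof (induction j)
  case (Suc j)
  have "set (replicate j 0 @ w) \<subseteq> {..<k}" using assms(2,3) by auto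
  with assms(1) Suc show ?case by (auto simp: ignores_leading_zeros_def)
qed simp

definition reachable :: "nat \<Rightarrow> ('s, 'o) dao \<Rightarrow> 's set" where
  "reachable k M = run M (init M) ` lists {..<k}"

definition behaviour :: "nat \<Rightarrow> ('s, 'o) dao \<Rightarrow> 's \<Rightarrow> nat list \<Rightarrow> 'o" where
  "behaviour k M s = restrict (\<lambda>w. out M (run M s w)) (lists {..<k})"

lemma behaviour_eq_iff:
  "behaviour k M s = behaviour k M t \<longleftrightarrow>
    (\<forall>w\<in>lists {..<k}. out M (run M s w) = out M (run M t w))"
  unfolding behaviour_def restrict_def fun_eq_iff by auto

lemma behaviour_eq_trans:
  assumes "behaviour k M s = behaviour k M t" "i < k"
  shows "behaviour k M (trans M s i) = behaviour k M (trans M t i)"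
  unfolding behaviour_eq_iff
proof
  fix w assume "w \<in> lists {..<k}"
  then have "i # w \<in> lists {..<k}" using assms(2) by simp
  then have "out M (run M s (i # w)) = out M (run M t (i # w))"
    using assms(1) unfolding behaviour_eq_iff by blast
  then show "out M (run M (trans M s i) w) = out M (run M (trans M t i) w)" by simp
qed

lemma init_reachable: "init M \<in> reachable k M"
  unfolding reachable_def by (rule image_eqI[of _ _ "[]"]) auto

lemma trans_reachable:
  assumes "s \<in> reachable k M" "i < k"
  shows "trans M s i \<in> reachable k M"
proof -
  obtain w where "w \<in> lists {..<k}" "s = run M (init M) w"
    using assms(1) unfolding reachable_def by auto
  then show ?thesis
    unfolding reachable_def using assms(2)
    by (intro image_eqI[of _ _ "w @ [i]"]) (auto simp: run_append)
qed

lemma reachable_subset: "is_dao k M \<Longrightarrow> reachable k M \<subseteq> states M"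
  unfolding reachable_def using run_in_states[of k M "init M"] by (auto simp: is_dao_def)

lemma minimal_dfao_reduced:
  fixes M :: "('s, 'o) dao"
  assumes "minimal_dfao k M"
  shows "reachable k M = states M" "inj_on (behaviour k M) (states M)"
proof -
  let ?R = "reachable k M" and ?beh = "behaviour k M"
  have dao: "is_dao k M" and fin: "finite (states M)"
    using assms by (auto simp: minimal_dfao_def is_dfao_def)
  have RS: "?R \<subseteq> states M" using dao by (rule reachable_subset)
  then have finR: "finite ?R" using fin by (rule finite_subset)
  then obtain g :: "(nat list \<Rightarrow> 'o) \<Rightarrow> nat" where g: "inj_on g (?beh ` ?R)"
    using finite_imp_inj_to_nat_seg[of "?beh ` ?R"] by auto
  define h where "h s = g (?beh s)" for s
  define r where "r = inv_into ?R h"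
  have h_eq: "?beh s = ?beh t" if "h s = h t" "s \<in> ?R" "t \<in> ?R" for s t
    using that g unfolding h_def inj_on_def by blast
  have r_in: "r (h s) \<in> ?R" and beh_r: "?beh (r (h s)) = ?beh s" if "s \<in> ?R" for s
  proof -
    show R: "r (h s) \<in> ?R" unfolding r_def using that by (simp add: inv_into_into)
    have "h (r (h s)) = h s" unfolding r_def using that by (simp add: f_inv_into_f)
    then show "?beh (r (h s)) = ?beh s" using R that by (rule h_eq)
  qed
  define N :: "(nat, 'o) dao" where
    "N = \<lparr>states = h ` ?R, init = h (init M), trans = \<lambda>n i. h (trans M (r n) i),
          outputs = outputs M, out = \<lambda>n. out M (r n)\<rparr>"
  have N_trans: "trans N (h s) i = h (trans M s i)" if "s \<in> ?R" "i < k" for s i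
    using behaviour_eq_trans[OF beh_r[OF that(1)] that(2)] by (simp add: N_def h_def)
  have N_out: "out N (h s) = out M s" if "s \<in> ?R" for s
    using beh_r[OF that] unfolding behaviour_eq_iff by (auto simp: N_def dest: bspec[of _ _ "[]"])
  have N_run: "out N (run N (h s) w) = out M (run M s w)"
    if "w \<in> lists {..<k}" "s \<in> ?R" for s w
    using that
  proof (induction w arbitrary: s)
    case (Cons i w)
    then show ?case using trans_reachable[of s k M i] by (simp add: N_trans)
  qed (simp add: N_out)
  have "is_dao k N"
    unfolding is_dao_def
  proof (intro conjI ballI allI impI)
    show "2 \<le> k" using dao by (simp add: is_dao_def)
    show "init N \<in> states N" using init_reachable[of M k] by (simp add: N_def)
  next
    fix n i assume "n \<in> states N" "i < k"
    then show "trans N n i \<in> states N"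
      using r_in trans_reachable by (fastforce simp: N_def)
  next
    fix n assume "n \<in> states N"
    then show "out N n \<in> outputs N"
      using r_in RS dao by (fastforce simp: N_def is_dao_def)
  qed
  then have "is_dfao k N" using finR by (simp add: is_dfao_def N_def)
  moreover have "equivalent k M N"
    using N_run[OF _ init_reachable]
    unfolding equivalent_def word_fun_def by (auto simp: N_def lists_eq_set)
  ultimately have "card (states M) \<le> card (h ` ?R)"
    using assms unfolding minimal_dfao_def by (force simp: N_def)
  moreover have "card (h ` ?R) \<le> card ?R" using finR by (rule card_image_le)
  moreover have "card ?R \<le> card (states M)" using fin RS by (rule card_mono)
  ultimately have eq: "card ?R = card (states M)" "card (h ` ?R) = card ?R" by auto
  show R: "?R = states M" using card_subset_eq[OF fin RS eq(1)] .
  have "inj_on h ?R" using finR eq(2) by (rule eq_card_imp_inj_on)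
  then show "inj_on ?beh (states M)" unfolding R h_def inj_on_def by metis
qed

lemma minimal_dfao_run_eq:
  assumes "minimal_dfao k M" "v \<in> lists {..<k}" "w \<in> lists {..<k}"
    and "\<And>u. u \<in> lists {..<k} \<Longrightarrow> word_fun M (v @ u) = word_fun M (w @ u)"
  shows "run M (init M) v = run M (init M) w"
proof (rule inj_onD[OF minimal_dfao_reduced(2)[OF assms(1)]])
  show "behaviour k M (run M (init M) v) = behaviour k M (run M (init M) w)"
    using assms(4) by (simp add: behaviour_eq_iff word_fun_def run_append)
  show "run M (init M) v \<in> states M" "run M (init M) w \<in> states M"
    using minimal_dfao_reduced(1)[OF assms(1)] assms(2,3) by (auto simp: reachable_def)
qed

lemma minimal_generator_word_fun:
  assumes "minimal_generator k A b M"
  shows "word_fun M (replicate j 0 @ rep k n) = b n"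
proof -
  have "2 \<le> k" and "ignores_leading_zeros k M" and "generates_direct k M b"
    using assms by (auto simp: minimal_generator_def minimal_dfao_def is_dfao_def is_dao_def)
  then show ?thesis
    by (simp add: word_fun_leading_zeros rep_in_lists generates_direct_def)
qed

theorem lemma3p1:
  fixes p :: nat
    and a :: "nat \<Rightarrow> (nat \<Rightarrow> int)"
    and M :: "nat \<Rightarrow> ('s, int) dao"
  assumes "prime p"
    and "\<forall>n. a n \<in> padic_ints p"
    and "\<forall>\<alpha>. automatic p (\<lambda>n. padic_mod \<alpha> (a n))"
    and "\<forall>\<alpha>. minimal_generator p (Zmod p \<alpha>) (\<lambda>n. padic_mod \<alpha> (a n)) (M \<alpha>)"
  shows "inverse_family p M"
proof -
  let ?W = "lists {..<p}"
  let ?run = "\<lambda>\<alpha>. run (M \<alpha>) (init (M \<alpha>))"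
  have gen: "minimal_generator p (Zmod p \<alpha>) (\<lambda>n. padic_mod \<alpha> (a n)) (M \<alpha>)" for \<alpha>
    using assms(4) by blast
  have min: "minimal_dfao p (M \<alpha>)" and outs: "outputs (M \<alpha>) = Zmod p \<alpha>" for \<alpha>
    using gen[of \<alpha>] by (auto simp: minimal_generator_def)
  have dfao: "is_dfao p (M \<alpha>)" for \<alpha> using min by (simp add: minimal_dfao_def)
  have dao: "is_dao p (M \<alpha>)" for \<alpha> using dfao by (simp add: is_dfao_def)
  have states: "states (M \<alpha>) = ?run \<alpha> ` ?W" for \<alpha>
    using minimal_dfao_reduced(1)[OF min] by (simp add: reachable_def)
  have proj_word: "proj p \<alpha> (word_fun (M \<beta>) w) = word_fun (M \<alpha>) w"
    if le: "\<alpha> \<le> \<beta>" and w_in: "w \<in> ?W" for \<alpha> \<beta> w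
  proof -
    obtain j n where w: "w = replicate j 0 @ rep p n"
      using word_eq_zeros_rep[OF _ w_in] prime_ge_2_nat[OF assms(1)] by blast
    show ?thesis
      using assms(2) le minimal_generator_word_fun[OF gen]
      by (simp add: w padic_mod_def padic_ints_def)
  qed
  define \<psi> where "\<psi> \<alpha> \<beta> s = ?run \<alpha> (SOME w. w \<in> ?W \<and> ?run \<beta> w = s)" for \<alpha> \<beta> s
  have \<psi>: "\<psi> \<alpha> \<beta> (?run \<beta> w) = ?run \<alpha> w" if le: "\<alpha> \<le> \<beta>" and w: "w \<in> ?W" for \<alpha> \<beta> w
  proof -
    define v where "v = (SOME v. v \<in> ?W \<and> ?run \<beta> v = ?run \<beta> w)"
    have "v \<in> ?W \<and> ?run \<beta> v = ?run \<beta> w"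
      unfolding v_def by (rule someI[of _ w]) (use w in simp)
    then have v: "v \<in> ?W" "?run \<beta> v = ?run \<beta> w" by auto
    have "?run \<alpha> v = ?run \<alpha> w"
    proof (rule minimal_dfao_run_eq[OF min v(1) w])
      fix u assume u: "u \<in> ?W"
      have "word_fun (M \<beta>) (v @ u) = word_fun (M \<beta>) (w @ u)"
        using v(2) by (simp add: word_fun_def run_append)
      then show "word_fun (M \<alpha>) (v @ u) = word_fun (M \<alpha>) (w @ u)"
        using proj_word[OF le, of "v @ u"] proj_word[OF le, of "w @ u"] u v(1) w by simp
    qed
    then show ?thesis by (simp add: \<psi>_def v_def)
  qed
  have "dao_morphism p (M \<beta>) (M \<alpha>) (\<psi> \<alpha> \<beta>) (proj p \<alpha>)" if le: "\<alpha> \<le> \<beta>" for \<alpha> \<beta>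
    unfolding dao_morphism_def
  proof (intro conjI ballI allI impI)
    show "\<psi> \<alpha> \<beta> \<in> states (M \<beta>) \<rightarrow> states (M \<alpha>)"
      using \<psi>[OF le] by (auto simp: states simp del: in_lists_conv_set)
    show "proj p \<alpha> \<in> outputs (M \<beta>) \<rightarrow> outputs (M \<alpha>)"
      using prime_gt_0_nat[OF assms(1)] by (auto simp: outs proj_def residue_ring_def)
    show "\<psi> \<alpha> \<beta> (init (M \<beta>)) = init (M \<alpha>)" using \<psi>[OF le, of "[]"] by simp
  next
    fix s i assume "s \<in> states (M \<beta>)" and i: "i < p"
    then obtain w where w: "w \<in> ?W" "s = ?run \<beta> w" by (auto simp: states)
    have "w @ [i] \<in> ?W" using w(1) i by simp
    from \<psi>[OF le this] show "\<psi> \<alpha> \<beta> (trans (M \<beta>) s i) = trans (M \<alpha>) (\<psi> \<alpha> \<beta> s) i"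
      by (simp add: w(2) run_append \<psi>[OF le w(1)])
  next
    fix s assume "s \<in> states (M \<beta>)"
    then obtain w where w: "w \<in> ?W" "s = ?run \<beta> w" by (auto simp: states)
    show "proj p \<alpha> (out (M \<beta>) s) = out (M \<alpha>) (\<psi> \<alpha> \<beta> s)"
      using proj_word[OF le w(1)] by (simp add: w(2) word_fun_def \<psi>[OF le w(1)])
  qed
  moreover have "\<psi> \<alpha> \<gamma> s = \<psi> \<alpha> \<beta> (\<psi> \<beta> \<gamma> s)"
    if le: "\<alpha> \<le> \<beta>" "\<beta> \<le> \<gamma>" and s: "s \<in> states (M \<gamma>)" for \<alpha> \<beta> \<gamma> s
  proof -
    obtain w where "w \<in> ?W" "s = ?run \<gamma> w" using s by (auto simp: states)
    then show ?thesis using \<psi> le order_trans[OF le] by simp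
  qed
  ultimately show ?thesis
    unfolding inverse_family_def using dfao outs by blast
qed

end
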